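(* Let $P=\{1,\dots,n\}$, $m\in\{1,\dots,n\}$, $\mathcal{X}=\{x\subseteq P: |x|=m\}$ with the Hamming distance $d(x,x')=\sum_{j\in x}\mathbf{1}_{j\notin x'}$, let $X:\Omega\to\mathcal{X}$ be a random variable on a probability space $(\Omega,\mathscr{A},\mathbb{P})$, let $i\in P$, let $x^-\subset P\setminus\{i\}$ with $|x^-|=m-1$, and put $I_i=\{\omega\in\Omega: i\in X(\omega)\}$ and $\mathcal{A}=\{\omega\in\Omega: x^-\subset X(\omega)\}$. Assume $\mathbb{P}(I_i\cap\mathcal{A})>0$ and $\mathbb{P}(I_i^c\cap\mathcal{A})>0$. Let $\varepsilon',\delta'\in\mathbb{R}_{\ge 0}$ and let $M:\mathcal{X}\times[0,1]\to\mathcal{T}$ be a data-release mechanism satisfying $(\varepsilon',\delta')$-approximate differential privacy, and assume that its family of output distributions $\{P_x\}_{x\in\mathcal{X}}$ is dominated by a $\sigma$-finite measure $\nu$ on $(\mathcal{T},\mathscr{F})$. Let $\delta\in(\delta',1)$ and $$\varepsilon=\log\left(\frac{\delta e^{\varepsilon'}+\delta'}{\delta-\delta'}\right).$$ Then $(\varepsilon,\delta)$-bad regions $S^{\delta}_{x,x'}$ exist for all $x,x'\in\mathcal{X}$ with $d(x,x')=1$, and for any choice of such bad regions, if $x\in X(I_i\cap\mathcal{A})$, then $$\frac{1}{\mathbb{P}(I_i\mid\mathcal{A})+(1-\mathbb{P}(I_i\mid\mathcal{A}))e^{\varepsilon}}\;\le\;\mathscr{R}(t)\;\le\;\frac{1}{\mathbb{P}(I_i\mid\mathcal{A})+(1-\mathbb{P}(I_i\mid\mathcal{A}))e^{-\varepsilon}}$$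 for $\nu$-almost every $t\in\mathcal{T}\setminus S^{\delta}_x$ at which $\mathscr{R}(t)$ is defined, where $S^{\delta}_x=\bigcup_{x'\in X(I_i^c\cap\mathcal{A})}S^{\delta}_{x,x'}$ and $\mathscr{R}(t)$ is the posterior-to-prior ratio of the event $I_i$ given $\mathcal{A}$ (see context).
   Context: Data-release mechanism: $(\mathcal{T},\mathscr{F})$ is a standard Borel space; a map $M:\mathcal{X}\times[0,1]\to\mathcal{T}$ is a data-release mechanism if $M(x,\cdot)$ is Borel-$\mathscr{F}$-measurable for each $x\in\mathcal{X}$. Its output distributions are $P_x(S)=\lambda(\{u\in[0,1]: M(x,u)\in S\})$, $S\in\mathscr{F}$, with $\lambda$ Lebesgue measure. $(\varepsilon',\delta')$-approximate differential privacy: $P_x(S)\le e^{\varepsilon'}P_{x'}(S)+\delta'$ for all $x,x'\in\mathcal{X}$ with $d(x,x')=1$ and all $S\in\mathscr{F}$. $(\varepsilon,\delta)$-bad region for a pair $x,x'$ with $d(x,x')=1$: a set $S^{\delta}_{x,x'}\in\mathscr{F}$ with $P_x(S^{\delta}_{x,x'})\le\delta$ such that $e^{-\varepsilon}P_{x'}(S\setminus S^{\delta}_{x,x'})\le P_x(S\setminus S^{\delta}_{x,x'})\le e^{\varepsilon}P_{x'}(S\setminus S^{\delta}_{x,x'})$ for all $S\in\mathscr{F}$. ($M$ satisfies $(\varepsilon,\delta)$-probabilistic differential privacy if a bad region exists for every such pair.) Conditional quantities: $p_x$ denotes a density of $P_x$ with respect to $\nu$. For $t\in\mathcal{T}$ and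 $I\in\mathscr{A}$, $P_{M,X}(t,I)=\int_I p_{X(\omega)}(t)\,d\mathbb{P}(\omega)$ (a finite sum, since $\mathcal{X}$ is finite and carries the discrete $\sigma$-algebra). For $t$ with $P_{M,X}(t,\mathcal{A})>0$, $P_{X\mid M}(I\mid t,\mathcal{A})=P_{M,X}(t,I\cap\mathcal{A})/P_{M,X}(t,\mathcal{A})$. The posterior-to-prior ratio is $\mathscr{R}(t)=P_{X\mid M}(I_i\mid t,\mathcal{A})/\mathbb{P}(I_i\mid\mathcal{A})$, defined for those $t$ with $P_{M,X}(t,\mathcal{A})>0$. $X(E)$ denotes the image of $E\subseteq\Omega$ under $X$. *)

theory Defs
  imports "HOL-Probability.Probability"
begin

(* Only the measurable structure of F matters; the measure it carries is ignored. *)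
definition standard_borel :: "'t measure \<Rightarrow> bool" where
  "standard_borel F \<longleftrightarrow>
    (\<exists>T. completely_metrizable_space T \<and> second_countable T \<and>
         topspace T = space F \<and> sets F = sigma_sets (space F) {U. openin T U})"

definition databases :: "nat \<Rightarrow> nat \<Rightarrow> nat set set" where
  "databases n m = {x. x \<subseteq> {1..n} \<and> card x = m}"

definition hamming :: "nat set \<Rightarrow> nat set \<Rightarrow> nat" where
  "hamming x x' = (\<Sum>j\<in>x. of_bool (j \<notin> x'))"

abbreviation lebesgue01 :: "real measure" where
  "lebesgue01 \<equiv> restrict_space lborel {0..1}"

definition data_release_mechanism ::
  "'x set \<Rightarrow> 't measure \<Rightarrow> ('x \<Rightarrow> real \<Rightarrow> 't) \<Rightarrow> bool" where
  "data_release_mechanism XX F M \<longleftrightarrow> standard_borel F \<and>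
    (\<forall>x\<in>XX. M x \<in> measurable (restrict_space borel {0..1}) F)"

definition output_dist :: "'t measure \<Rightarrow> ('x \<Rightarrow> real \<Rightarrow> 't) \<Rightarrow> 'x \<Rightarrow> 't measure" where
  "output_dist F M x = distr lebesgue01 F (M x)"

definition approximate_DP ::
  "'x set \<Rightarrow> ('x \<Rightarrow> 'x \<Rightarrow> nat) \<Rightarrow> 't measure \<Rightarrow> ('x \<Rightarrow> real \<Rightarrow> 't) \<Rightarrow> real \<Rightarrow> real \<Rightarrow> bool" where
  "approximate_DP XX d F M \<epsilon> \<delta> \<longleftrightarrow>
    (\<forall>x\<in>XX. \<forall>x'\<in>XX. d x x' = 1 \<longrightarrow>
      (\<forall>S\<in>sets F. measure (output_dist F M x) S
                    \<le> exp \<epsilon> * measure (output_dist F M x') S + \<delta>))"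

definition bad_region ::
  "'t measure \<Rightarrow> ('x \<Rightarrow> real \<Rightarrow> 't) \<Rightarrow> real \<Rightarrow> real \<Rightarrow> 'x \<Rightarrow> 'x \<Rightarrow> 't set \<Rightarrow> bool" where
  "bad_region F M \<epsilon> \<delta> x x' B \<longleftrightarrow>
    B \<in> sets F \<and> measure (output_dist F M x) B \<le> \<delta> \<and>
    (\<forall>S\<in>sets F.
       exp (- \<epsilon>) * measure (output_dist F M x') (S - B) \<le> measure (output_dist F M x) (S - B) \<and>
       measure (output_dist F M x) (S - B) \<le> exp \<epsilon> * measure (output_dist F M x') (S - B))"

definition is_density :: "'t measure \<Rightarrow> 't measure \<Rightarrow> ('t \<Rightarrow> real) \<Rightarrow> bool" where
  "is_density \<nu> P p \<longleftrightarrow>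
    p \<in> borel_measurable \<nu> \<and> (\<forall>t\<in>space \<nu>. 0 \<le> p t) \<and> P = density \<nu> (\<lambda>t. ennreal (p t))"

definition joint_density ::
  "'w measure \<Rightarrow> ('w \<Rightarrow> 'x) \<Rightarrow> ('x \<Rightarrow> 't \<Rightarrow> real) \<Rightarrow> 't \<Rightarrow> 'w set \<Rightarrow> real" where
  "joint_density Pr X p t I = (LINT \<omega>:I|Pr. p (X \<omega>) t)"

(* Meaningful only where joint_density Pr X p t A > 0. *)
definition posterior ::
  "'w measure \<Rightarrow> ('w \<Rightarrow> 'x) \<Rightarrow> ('x \<Rightarrow> 't \<Rightarrow> real) \<Rightarrow> 'w set \<Rightarrow> 't \<Rightarrow> 'w set \<Rightarrow> real" where
  "posterior Pr X p I t A = joint_density Pr X p t (I \<inter> A) / joint_density Pr X p t A"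

definition prior :: "'w measure \<Rightarrow> 'w set \<Rightarrow> 'w set \<Rightarrow> real" where
  "prior Pr I A = \<P>(\<omega> in Pr. \<omega> \<in> I \<bar> \<omega> \<in> A)"

definition posterior_prior_ratio ::
  "'w measure \<Rightarrow> ('w \<Rightarrow> 'x) \<Rightarrow> ('x \<Rightarrow> 't \<Rightarrow> real) \<Rightarrow> 'w set \<Rightarrow> 'w set \<Rightarrow> 't \<Rightarrow> real" where
  "posterior_prior_ratio Pr X p I A t = posterior Pr X p I t A / prior Pr I A"

end

theory Submission
  imports Defs
begin

text \<open>
  By the Hahn decomposition there are sets \<open>Y\<close> and \<open>Z\<close> on which \<open>P\<^sub>x\<close> dominates \<open>e\<^sup>\<epsilon> P\<^sub>x\<^sub>'\<close> and
  \<open>P\<^sub>x\<^sub>'\<close> dominates \<open>e\<^sup>\<epsilon> P\<^sub>x\<close>, respectively, and off which the reverse inequalities hold; so \<open>Y \<union> Z\<close>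
  is a bad region once its probability is at most \<open>\<delta>\<close>. Approximate privacy gives
  \<open>P\<^sub>x(Y) \<le> e\<^sup>\<epsilon> \<delta>' / (e\<^sup>\<epsilon> - c)\<close> and \<open>P\<^sub>x(Z) \<le> \<delta>' / (e\<^sup>\<epsilon> - c)\<close> with \<open>c\<close> the exponential of
  \<open>\<epsilon>'\<close>, and the choice of \<open>\<epsilon>\<close> makes the sum of these bounds exactly \<open>\<delta>\<close>.

  For the posterior bounds, \<open>X = x\<close> holds throughout \<open>I \<inter> A\<close>, and every value \<open>y\<close> of \<open>X\<close> on \<open>A - I\<close>
  is at distance 1 from \<open>x\<close>. Outside the bad regions \<open>p\<^sub>y\<close> is almost everywhere within a factor
  \<open>e\<^sup>\<epsilon>\<close> of \<open>p\<^sub>x\<close>, so integrating over \<open>A - I\<close> controls the denominator of the posterior.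
\<close>

section \<open>Hamming distance between databases of equal size\<close>

lemma hamming_eq_card_Diff: "finite x \<Longrightarrow> hamming x x' = card (x - x')"
  unfolding hamming_def of_bool_def
  by (simp add: sum.If_cases set_diff_eq Collect_conj_eq)

lemma finite_databases: "finite (databases n m)"
  unfolding databases_def by simp

lemma finite_database: "x \<in> databases n m \<Longrightarrow> finite x"
  unfolding databases_def by (auto intro: finite_subset)

text \<open>Both set differences arise by removing the common part from sets of equal size. The
  symmetry makes approximate privacy available in both directions.\<close>

lemma hamming_commute:
  assumes "x \<in> databases n m" "y \<in> databases n m"
  shows "hamming x y = hamming y x"
proof -
  have "finite x" "finite y"
    using assms by (blast intro: finite_database)+
  moreover have "card x = card y"
    using assms by (simp add: databases_def)
  ultimately show ?thesis
    using card_Diff_subset_Int[of x y] card_Diff_subset_Int[of y x]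
    by (simp add: hamming_eq_card_Diff Int_commute[of y x])
qed

text \<open>Counting forces \<open>x = insert i xm\<close>, so \<open>i\<close> is the only element
  of \<open>x\<close> missing from \<open>y\<close>.\<close>

lemma hamming_common_subset:
  assumes "x \<in> databases n m" "y \<in> databases n m" "m \<ge> 1"
    and "xm \<subseteq> x" "xm \<subseteq> y" "card xm = m - 1" "i \<in> x" "i \<notin> y"
  shows "hamming x y = 1"
proof -
  have fx: "finite x"
    using assms(1) by (rule finite_database)
  have cx: "card x = m"
    using assms(1) by (simp add: databases_def)
  have "finite xm"
    using assms(4) fx by (rule finite_subset)
  moreover have "i \<notin> xm"
    using assms(5,8) by blast
  ultimately have "card (insert i xm) = card x"
    using assms(3,6) cx by simp
  then have "x = insert i xm"
    using card_subset_eq[OF fx, of "insert i xm"] assms(4,7) by auto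
  then have "x - y = {i}"
    using assms(5,8) by auto
  then show ?thesis
    using fx by (simp add: hamming_eq_card_Diff)
qed

section \<open>Output distributions and the existence of bad regions\<close>

lemma sets_output_dist [simp]: "sets (output_dist F M x) = sets F"
  by (simp add: output_dist_def)

lemma prob_space_output_dist:
  assumes "data_release_mechanism XX F M" "x \<in> XX"
  shows "prob_space (output_dist F M x)"
proof -
  have "prob_space lebesgue01"
    by (rule prob_space_restrict_space) auto
  moreover have "sets lebesgue01 = sets (restrict_space borel {0..1::real})"
    by (rule sets_restrict_space_cong) simp
  then have "M x \<in> measurable lebesgue01 F"
    using assms measurable_cong_sets[OF _ refl]
    unfolding data_release_mechanism_def by blast
  ultimately show ?thesis
    unfolding output_dist_def by (rule prob_space.prob_space_distr)
qed

text \<open>The unsigned Hahn decomposition is applied to \<open>P\<close> and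
  \<open>scale_measure (ennreal c) Q\<close>; finiteness of both allows the passage to real-valued
  measures.\<close>

lemma Hahn_decomposition_scaled:
  fixes c :: real
  assumes "finite_measure P" "finite_measure Q" "sets Q = sets P" "c \<ge> 0"
  obtains Y where "Y \<in> sets P"
    and "\<And>S. S \<in> sets P \<Longrightarrow> S \<subseteq> Y \<Longrightarrow> c * measure Q S \<le> measure P S"
    and "\<And>S. S \<in> sets P \<Longrightarrow> S \<inter> Y = {} \<Longrightarrow> measure P S \<le> c * measure Q S"
proof -
  interpret P: finite_measure P by fact
  interpret Q: finite_measure Q by fact
  let ?N = "scale_measure (ennreal c) Q"
  have N: "emeasure ?N S = ennreal (c * measure Q S)" for S
    unfolding emeasure_scale_measure Q.emeasure_eq_measure
    using assms(4) measure_nonneg by (rule ennreal_mult[symmetric])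
  have "finite_measure ?N"
    by (rule finite_measureI) (simp only: N, simp)
  then obtain Y where Y: "Y \<in> sets P"
    "\<And>S. S \<in> sets P \<Longrightarrow> S \<subseteq> Y \<Longrightarrow> emeasure ?N S \<le> emeasure P S"
    "\<And>S. S \<in> sets P \<Longrightarrow> S \<inter> Y = {} \<Longrightarrow> emeasure P S \<le> emeasure ?N S"
    using finite_unsigned_Hahn_decomposition[of P ?N] assms(1,3) by (metis sets_scale_measure)
  show thesis
  proof (rule that[OF Y(1)])
    fix S assume S: "S \<in> sets P"
    show "c * measure Q S \<le> measure P S" if "S \<subseteq> Y"
      using Y(2)[OF S that] unfolding N P.emeasure_eq_measure by (rule ennreal_le_iff[THEN iffD1, rotated]) simp
    show "measure P S \<le> c * measure Q S" if "S \<inter> Y = {}"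
      using Y(3)[OF S that] unfolding N P.emeasure_eq_measure
      by (rule ennreal_le_iff[THEN iffD1, rotated]) (simp add: assms(4))
  qed
qed

text \<open>Here \<open>a\<close>, \<open>b\<close>, \<open>c\<close>, \<open>e\<close> stand for
  \<open>P Y\<close>, \<open>P Z\<close>, \<open>exp \<epsilon>\<close>,
  \<open>exp \<epsilon>'\<close>. The value of \<open>c\<close> solves
  \<open>(c + 1) * \<delta>' = (c - e) * \<delta>\<close>, whose left side is the sum of the two
  bounds; \<open>0 < \<delta>'\<close> makes \<open>c - e\<close> positive, so that it
  cancels.\<close>

lemma bad_region_budget:
  fixes a b c e \<delta> \<delta>' :: real
  assumes "0 < \<delta>'" "\<delta>' < \<delta>" "0 < e" "c = (\<delta> * e + \<delta>') / (\<delta> - \<delta>')"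
    and "(c - e) * a \<le> c * \<delta>'" "(c - e) * b \<le> \<delta>'"
  shows "a + b \<le> \<delta>"
proof -
  have ce: "c - e = \<delta>' * (1 + e) / (\<delta> - \<delta>')" and c1: "c + 1 = \<delta> * (1 + e) / (\<delta> - \<delta>')"
    using assms(2,4) by (auto simp: field_simps)
  have "c - e > 0"
    unfolding ce using assms(1-3) by simp
  moreover have "(c - e) * (a + b) \<le> (c + 1) * \<delta>'"
    using assms(5,6) by (simp add: algebra_simps)
  moreover have "(c + 1) * \<delta>' = (c - e) * \<delta>"
    unfolding ce c1 by simp
  ultimately show ?thesis
    by simp
qed

lemma bad_region_exists:
  fixes \<epsilon> \<epsilon>' \<delta> \<delta>' :: real
  assumes M: "data_release_mechanism XX F M" and x: "x \<in> XX" "x' \<in> XX"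
    and DP: "\<And>S. S \<in> sets F \<Longrightarrow> measure (output_dist F M x) S
        \<le> exp \<epsilon>' * measure (output_dist F M x') S + \<delta>'"
      "\<And>S. S \<in> sets F \<Longrightarrow> measure (output_dist F M x') S
        \<le> exp \<epsilon>' * measure (output_dist F M x) S + \<delta>'"
    and \<delta>: "0 \<le> \<delta>'" "\<delta>' < \<delta>"
    and \<epsilon>: "\<epsilon> = ln ((\<delta> * exp \<epsilon>' + \<delta>') / (\<delta> - \<delta>'))"
  shows "\<exists>B. bad_region F M \<epsilon> \<delta> x x' B"
proof -
  define P Q where "P = output_dist F M x" and "Q = output_dist F M x'"
  interpret P: prob_space P
    unfolding P_def by (rule prob_space_output_dist[OF M x(1)])
  interpret Q: prob_space Q
    unfolding Q_def by (rule prob_space_output_dist[OF M x(2)])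
  have sets: "sets P = sets F" "sets Q = sets F"
    by (simp_all add: P_def Q_def)
  have DP_P: "measure P S \<le> exp \<epsilon>' * measure Q S + \<delta>'"
    and DP_Q: "measure Q S \<le> exp \<epsilon>' * measure P S + \<delta>'" if "S \<in> sets F" for S
    using DP that by (auto simp: P_def Q_def)
  have "0 < \<delta> * exp \<epsilon>' + \<delta>'"
    using \<delta> by (simp add: add_pos_nonneg)
  then have c: "exp \<epsilon> = (\<delta> * exp \<epsilon>' + \<delta>') / (\<delta> - \<delta>')"
    using \<delta> \<epsilon> by (simp add: exp_ln)
  \<comment> \<open>Turns the lower bound in \<open>bad_region\<close> into an upper bound with the
    two measures exchanged, the form that \<open>Z\<close> provides.\<close>
  have flip: "exp (- e) * b \<le> a \<longleftrightarrow> b \<le> exp e * a" for a b e :: real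
    by (simp add: exp_minus field_simps)
  show ?thesis
  proof (cases "\<delta>' = 0")
    case True
    \<comment> \<open>Here the budget computation below degenerates to 0 \<le> 0, but M is purely private.\<close>
    then have "exp \<epsilon> = exp \<epsilon>'"
      using c \<delta> by simp
    then have "bad_region F M \<epsilon> \<delta> x x' {}"
      using DP_P DP_Q True \<delta> by (simp add: bad_region_def flip P_def Q_def)
    then show ?thesis ..
  next
    case False
    obtain Y where Y: "Y \<in> sets F"
      "\<And>S. S \<in> sets F \<Longrightarrow> S \<subseteq> Y \<Longrightarrow> exp \<epsilon> * measure Q S \<le> measure P S"
      "\<And>S. S \<in> sets F \<Longrightarrow> S \<inter> Y = {} \<Longrightarrow> measure P S \<le> exp \<epsilon> * measure Q S"
      using Hahn_decomposition_scaled[OF P.finite_measure_axioms Q.finite_measure_axioms, of "exp \<epsilon>"]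
      unfolding sets by auto
    obtain Z where Z: "Z \<in> sets F"
      "\<And>S. S \<in> sets F \<Longrightarrow> S \<subseteq> Z \<Longrightarrow> exp \<epsilon> * measure P S \<le> measure Q S"
      "\<And>S. S \<in> sets F \<Longrightarrow> S \<inter> Z = {} \<Longrightarrow> measure Q S \<le> exp \<epsilon> * measure P S"
      using Hahn_decomposition_scaled[OF Q.finite_measure_axioms P.finite_measure_axioms, of "exp \<epsilon>"]
      unfolding sets by auto
    \<comment> \<open>Privacy bounds \<open>P Y\<close> through \<open>Q Y\<close>; after scaling by
      \<open>exp \<epsilon>\<close>, domination on \<open>Y\<close> turns \<open>Q Y\<close> back
      into \<open>P Y\<close>.\<close>
    have "exp \<epsilon> * measure P Y \<le> exp \<epsilon>' * (exp \<epsilon> * measure Q Y) + exp \<epsilon> * \<delta>'"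
      using mult_left_mono[OF DP_P[OF Y(1)], of "exp \<epsilon>"] by (simp add: algebra_simps)
    also have "\<dots> \<le> exp \<epsilon>' * measure P Y + exp \<epsilon> * \<delta>'"
      using Y(2)[OF Y(1)] by simp
    finally have "(exp \<epsilon> - exp \<epsilon>') * measure P Y \<le> exp \<epsilon> * \<delta>'"
      by (simp add: algebra_simps)
    \<comment> \<open>The chain \<open>exp \<epsilon> * P Z \<le> Q Z \<le> exp \<epsilon>' * P Z +
      \<delta>'\<close> needs no scaling, hence the bound is smaller than the one for
      \<open>Y\<close> by the factor \<open>exp \<epsilon>\<close>.\<close>
    moreover have "(exp \<epsilon> - exp \<epsilon>') * measure P Z \<le> \<delta>'"
      using Z(2)[OF Z(1)] DP_Q[OF Z(1)] by (simp add: algebra_simps)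
    ultimately have "measure P Y + measure P Z \<le> \<delta>"
      using False \<delta> c by (intro bad_region_budget[of \<delta>' \<delta> "exp \<epsilon>'" "exp \<epsilon>"]) auto
    moreover have "measure P (Y \<union> Z) \<le> measure P Y + measure P Z"
      using Y(1) Z(1) sets by (intro measure_Un_le) auto
    \<comment> \<open>Every \<open>S - (Y \<union> Z)\<close> misses both sets, so the Hahn
      inequalities for disjoint sets apply to it.\<close>
    ultimately have "bad_region F M \<epsilon> \<delta> x x' (Y \<union> Z)"
      using Y(1,3) Z(1,3) unfolding bad_region_def flip P_def[symmetric] Q_def[symmetric]
      by (auto intro!: Y(3) Z(3))
    then show ?thesis ..
  qed
qed

section \<open>From inequalities between measures to inequalities between densities\<close>

text \<open>On the set \<open>N\<close> of violations outside \<open>B\<close>, \<open>c * q\<close>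
  is pointwise below \<open>p\<close>, yet the hypothesis bounds the integral of \<open>p\<close>
  over \<open>N\<close> by that of \<open>c * q\<close>. The two then agree almost everywhere on
  \<open>N\<close>, which makes \<open>N\<close> null.\<close>

lemma AE_le_density:
  fixes c :: real and p q :: "'t \<Rightarrow> real"
  assumes P: "finite_measure P" "is_density \<nu> P p" and Q: "finite_measure Q" "is_density \<nu> Q q"
    and "c \<ge> 0" and B: "B \<in> sets \<nu>"
    and le: "\<And>S. S \<in> sets \<nu> \<Longrightarrow> measure P (S - B) \<le> c * measure Q (S - B)"
  shows "AE t in \<nu>. t \<notin> B \<longrightarrow> p t \<le> c * q t"
proof -
  interpret P: finite_measure P by fact
  interpret Q: finite_measure Q by fact
  have [measurable]: "p \<in> borel_measurable \<nu>" "q \<in> borel_measurable \<nu>" "B \<in> sets \<nu>"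
    and nonneg: "\<And>t. t \<in> space \<nu> \<Longrightarrow> 0 \<le> p t" "\<And>t. t \<in> space \<nu> \<Longrightarrow> 0 \<le> q t"
    and dens: "P = density \<nu> (\<lambda>t. ennreal (p t))" "Q = density \<nu> (\<lambda>t. ennreal (q t))"
    using P Q B by (auto simp: is_density_def)
  define N where "N = {t \<in> space \<nu>. c * q t < p t} - B"
  have N [measurable]: "N \<in> sets \<nu>"
    unfolding N_def by measurable
  let ?f = "\<lambda>t. ennreal (c * q t) * indicator N t" and ?g = "\<lambda>t. ennreal (p t) * indicator N t"
  have fm: "?f \<in> borel_measurable \<nu>" and gm: "?g \<in> borel_measurable \<nu>"
    by measurable
  have "measure P N \<le> c * measure Q N"
    using le[OF N] by (simp add: N_def)
  moreover have "(\<integral>\<^sup>+t. ?f t \<partial>\<nu>) = ennreal c * emeasure Q N"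
  proof -
    have "(\<integral>\<^sup>+t. ?f t \<partial>\<nu>) = (\<integral>\<^sup>+t. ennreal c * (ennreal (q t) * indicator N t) \<partial>\<nu>)"
      using nonneg assms(5) by (intro nn_integral_cong) (simp add: ennreal_mult mult.assoc)
    then show ?thesis
      by (simp add: nn_integral_cmult dens(2) emeasure_density)
  qed
  then have f: "(\<integral>\<^sup>+t. ?f t \<partial>\<nu>) = ennreal (c * measure Q N)"
    using assms(5) by (simp add: Q.emeasure_eq_measure ennreal_mult)
  moreover have "(\<integral>\<^sup>+t. ?g t \<partial>\<nu>) = ennreal (measure P N)"
    using P.emeasure_eq_measure[of N] emeasure_density[of "\<lambda>t. ennreal (p t)" \<nu> N]
    by (simp add: dens(1)[symmetric])
  ultimately have "\<not> (\<integral>\<^sup>+t. ?f t \<partial>\<nu>) < (\<integral>\<^sup>+t. ?g t \<partial>\<nu>)"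
    using ennreal_leI by (simp add: not_less)
  moreover have "AE t in \<nu>. ?f t \<le> ?g t"
    by (auto simp: N_def indicator_def intro!: ennreal_leI)
  \<comment> \<open>An integrand larger on a non-null set has a strictly larger integral only if the
    smaller integral is finite.\<close>
  moreover have "(\<integral>\<^sup>+t. ?f t \<partial>\<nu>) \<noteq> \<infinity>"
    unfolding f by simp
  ultimately have "AE t in \<nu>. ?g t \<le> ?f t"
    using nn_integral_less[OF fm gm] by blast
  then show ?thesis
    using AE_space
  proof eventually_elim
    case (elim t)
    have "t \<notin> N"
    proof
      assume "t \<in> N"
      then have "p t \<le> c * q t"
        using elim nonneg(2) assms(5) by (simp add: ennreal_le_iff)
      with \<open>t \<in> N\<close> show False
        by (simp add: N_def)
    qed
    then show ?case
      using elim(2) by (auto simp: N_def)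
  qed
qed

lemma bad_region_AE:
  assumes M: "data_release_mechanism XX F M" "x \<in> XX" "x' \<in> XX"
    and p: "is_density \<nu> (output_dist F M x) p" "is_density \<nu> (output_dist F M x') q"
    and "sets \<nu> = sets F" "bad_region F M \<epsilon> \<delta> x x' B"
  shows "AE t in \<nu>. t \<notin> B \<longrightarrow> exp (- \<epsilon>) * q t \<le> p t \<and> p t \<le> exp \<epsilon> * q t"
proof -
  interpret P: prob_space "output_dist F M x" by (rule prob_space_output_dist) fact+
  interpret Q: prob_space "output_dist F M x'" by (rule prob_space_output_dist) fact+
  have "AE t in \<nu>. t \<notin> B \<longrightarrow> p t \<le> exp \<epsilon> * q t"
    using assms(7) by (intro AE_le_density[OF P.finite_measure_axioms p(1) Q.finite_measure_axioms p(2)])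
      (auto simp: bad_region_def assms(6))
  \<comment> \<open>The same lemma with the roles exchanged: the lower bound of the bad region,
    multiplied by \<open>exp \<epsilon>\<close>, is its hypothesis.\<close>
  moreover have "AE t in \<nu>. t \<notin> B \<longrightarrow> q t \<le> exp \<epsilon> * p t"
    using assms(7) by (intro AE_le_density[OF Q.finite_measure_axioms p(2) P.finite_measure_axioms p(1)])
      (auto simp: bad_region_def assms(6) exp_minus field_simps)
  ultimately show ?thesis
    by eventually_elim (auto simp: exp_minus field_simps)
qed

section \<open>The posterior-to-prior ratio at a fixed output\<close>

text \<open>In the application \<open>a\<close> and \<open>b\<close> are the probabilities of
  \<open>I \<inter> A\<close> and \<open>A - I\<close>, \<open>w\<close> is \<open>p x t\<close>,
  \<open>c\<close> is \<open>exp \<epsilon>\<close>, and \<open>J\<close> is the joint density over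
  \<open>A - I\<close>; \<open>r\<close> is then the prior. Cancelling \<open>w\<close> gives the
  ratio \<open>(a + b) / (a + J / w)\<close>, which decreases in \<open>J / w\<close>, and
  \<open>J / w\<close> lies between \<open>b / c\<close> and \<open>b * c\<close>.\<close>

lemma ratio_bounds:
  fixes a b w J c :: real
  assumes "a > 0" "b > 0" "c > 0" "w > 0" "w / c * b \<le> J" "J \<le> w * c * b"
  defines "r \<equiv> a / (a + b)"
  shows "1 / (r + (1 - r) * c) \<le> w * a / (w * a + J) / r"
    and "w * a / (w * a + J) / r \<le> 1 / (r + (1 - r) * (1 / c))"
proof -
  have "1 - r = b / (a + b)"
    using assms(1,2) by (simp add: r_def field_simps)
  then have r: "r + (1 - r) * d = (a + b * d) / (a + b)" for d
    by (simp add: r_def add_divide_distrib)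
  have J: "J \<ge> 0"
    using assms(2-5) by (smt (verit) divide_pos_pos mult_pos_pos)
  have R: "w * a / (w * a + J) / r = (a + b) / (a + J / w)"
  proof -
    have "w * a + J = w * (a + J / w)"
      using assms(4) by (simp add: distrib_left)
    then show ?thesis
      using assms(1,4) by (simp add: r_def)
  qed
  have "J / w \<le> b * c" "b / c \<le> J / w"
    using assms(3-6) by (simp_all add: field_simps)
  moreover have "0 < a + b / c" "0 \<le> J / w"
    using assms(1-4) J by (auto intro: add_pos_pos)
  ultimately show "1 / (r + (1 - r) * c) \<le> w * a / (w * a + J) / r"
    and "w * a / (w * a + J) / r \<le> 1 / (r + (1 - r) * (1 / c))"
    unfolding r R using assms(1,2) by (auto intro!: divide_left_mono)
qed

lemma prior_eq:
  assumes "prob_space Pr" "I \<in> sets Pr" "A \<in> sets Pr"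
  shows "prior Pr I A =
    measure Pr (I \<inter> A) / (measure Pr (I \<inter> A) + measure Pr ((space Pr - I) \<inter> A))"
proof -
  interpret prob_space Pr by fact
  have "measure Pr A = measure Pr ((I \<inter> A) \<union> ((space Pr - I) \<inter> A))"
    using sets.sets_into_space[OF assms(3)] by (intro arg_cong[of _ _ "measure Pr"]) auto
  also have "\<dots> = measure Pr (I \<inter> A) + measure Pr ((space Pr - I) \<inter> A)"
    using assms by (intro finite_measure_Union) auto
  finally have "measure Pr A = \<dots>" .
  moreover have "{\<omega> \<in> space Pr. \<omega> \<in> I \<and> \<omega> \<in> A} = I \<inter> A" "{\<omega> \<in> space Pr. \<omega> \<in> A} = A"
    using sets.sets_into_space[OF assms(3)] by auto
  ultimately show ?thesis
    by (simp add: prior_def cond_prob_def)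
qed

text \<open>The joint density over \<open>A\<close> splits into the part over
  \<open>I \<inter> A\<close>, where the integrand is constantly \<open>p x t\<close>, and the part
  over \<open>A - I\<close>, where it is within a factor \<open>exp \<epsilon>\<close> of
  \<open>p x t\<close>; \<open>ratio_bounds\<close> does the rest.\<close>

lemma posterior_prior_ratio_bounds:
  fixes p :: "'x \<Rightarrow> 't \<Rightarrow> real" and \<epsilon> :: real
  assumes "prob_space Pr" and X: "X \<in> measurable Pr (count_space D)" and "finite D"
    and I: "I \<in> sets Pr" and A: "A \<in> sets Pr"
    and a: "measure Pr (I \<inter> A) > 0" and b: "measure Pr ((space Pr - I) \<inter> A) > 0"
    and const: "\<And>\<omega>. \<omega> \<in> I \<inter> A \<Longrightarrow> X \<omega> = x" and w: "p x t \<ge> 0"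
    and close: "\<And>y. y \<in> X ` ((space Pr - I) \<inter> A) \<Longrightarrow>
      exp (- \<epsilon>) * p y t \<le> p x t \<and> p x t \<le> exp \<epsilon> * p y t"
    and pos: "joint_density Pr X p t A > 0"
  shows "1 / (prior Pr I A + (1 - prior Pr I A) * exp \<epsilon>) \<le> posterior_prior_ratio Pr X p I A t"
    and "posterior_prior_ratio Pr X p I A t \<le> 1 / (prior Pr I A + (1 - prior Pr I A) * exp (- \<epsilon>))"
proof -
  interpret prob_space Pr by fact
  define C where "C = (space Pr - I) \<inter> A"
  have C [measurable]: "C \<in> sets Pr" and IA [measurable]: "I \<inter> A \<in> sets Pr"
    using I A by (auto simp: C_def)
  \<comment> \<open>\<open>X\<close> takes finitely many values, so the sum of all
    \<open>\<bar>p y t\<bar>\<close> is a constant bound.\<close>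
  have "integrable Pr (\<lambda>\<omega>. p (X \<omega>) t)"
  proof (rule integrable_const_bound)
    show "(\<lambda>\<omega>. p (X \<omega>) t) \<in> borel_measurable Pr"
      using measurable_compose[OF X, of "\<lambda>y. p y t" borel] by simp
    show "AE \<omega> in Pr. norm (p (X \<omega>) t) \<le> (\<Sum>y\<in>D. \<bar>p y t\<bar>)"
      using measurable_space[OF X] \<open>finite D\<close>
      by (intro AE_I2) (auto intro!: member_le_sum)
  qed
  then have int: "set_integrable Pr E (\<lambda>\<omega>. p (X \<omega>) t)" if "E \<in> sets Pr" for E
    unfolding set_integrable_def by (rule integrable_mult_indicator[OF that])
  have const_int: "(LINT \<omega>:E|Pr. k) = k * measure Pr E"
      "set_integrable Pr E (\<lambda>_. k)" if "E \<in> sets Pr" for E and k :: real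
    using that by (auto simp: set_lebesgue_integral_def set_integrable_def emeasure_eq_measure)
  define J where "J = joint_density Pr X p t C"
  have jI: "joint_density Pr X p t (I \<inter> A) = p x t * measure Pr (I \<inter> A)"
    unfolding joint_density_def const_int(1)[OF IA, symmetric]
    by (rule set_lebesgue_integral_cong) (use IA const in auto)
  have "A = (I \<inter> A) \<union> C" "(I \<inter> A) \<inter> C = {}"
    using sets.sets_into_space[OF A] by (auto simp: C_def)
  then have jA: "joint_density Pr X p t A = p x t * measure Pr (I \<inter> A) + J"
    using set_integral_Un[of "I \<inter> A" C Pr "\<lambda>\<omega>. p (X \<omega>) t"] int IA C
    unfolding J_def jI[symmetric] joint_density_def by simp
  have bd: "p x t / exp \<epsilon> \<le> p (X \<omega>) t" "p (X \<omega>) t \<le> p x t * exp \<epsilon>" if "\<omega> \<in> C" for \<omega>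
    using close[of "X \<omega>"] that by (auto simp: C_def exp_minus field_simps)
  have J: "p x t / exp \<epsilon> * measure Pr C \<le> J" "J \<le> p x t * exp \<epsilon> * measure Pr C"
    unfolding J_def joint_density_def const_int(1)[OF C, symmetric]
    by (intro set_integral_mono int const_int C bd; assumption)+
  \<comment> \<open>If \<open>p x t\<close> were 0, the upper bound would give
    \<open>J \<le> 0\<close>, and the joint density over \<open>A\<close> could not be
    positive.\<close>
  have "p x t > 0"
    using w J(2) pos jA by (cases "p x t = 0") auto
  then show "1 / (prior Pr I A + (1 - prior Pr I A) * exp \<epsilon>) \<le> posterior_prior_ratio Pr X p I A t"
    and "posterior_prior_ratio Pr X p I A t \<le> 1 / (prior Pr I A + (1 - prior Pr I A) * exp (- \<epsilon>))"
    using ratio_bounds[OF a b exp_gt_zero _ J[unfolded C_def]]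
    by (simp_all add: posterior_prior_ratio_def posterior_def jI jA prior_eq[OF assms(1) I A]
        exp_minus inverse_eq_divide)
qed

section \<open>Assembly for databases of fixed size\<close>

theorem corollary2:
  fixes n m i :: nat and xm :: "nat set"
    and Pr :: "'w measure" and X :: "'w \<Rightarrow> nat set" and I A :: "'w set"
    and F \<nu> :: "'t measure" and M :: "nat set \<Rightarrow> real \<Rightarrow> 't"
    and \<epsilon>' \<delta>' \<epsilon> \<delta> :: real
  assumes "m \<in> {1..n}"
    and "prob_space Pr"
    and "X \<in> measurable Pr (count_space (databases n m))"
    and "i \<in> {1..n}"
    and "xm \<subseteq> {1..n} - {i}" and "card xm = m - 1"
    and I_def: "I = {\<omega> \<in> space Pr. i \<in> X \<omega>}"
    and A_def: "A = {\<omega> \<in> space Pr. xm \<subseteq> X \<omega>}"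
    and "measure Pr (I \<inter> A) > 0"
    and "measure Pr ((space Pr - I) \<inter> A) > 0"
    and "\<epsilon>' \<ge> 0" and "\<delta>' \<ge> 0"
    and "data_release_mechanism (databases n m) F M"
    and "approximate_DP (databases n m) hamming F M \<epsilon>' \<delta>'"
    and "sigma_finite_measure \<nu>" and "sets \<nu> = sets F"
    and "\<forall>x\<in>databases n m. absolutely_continuous \<nu> (output_dist F M x)"
    and "\<delta>' < \<delta>" and "\<delta> < 1"
    and "\<epsilon> = ln ((\<delta> * exp \<epsilon>' + \<delta>') / (\<delta> - \<delta>'))"
  shows "(\<forall>x\<in>databases n m. \<forall>x'\<in>databases n m. hamming x x' = 1 \<longrightarrow>
            (\<exists>B. bad_region F M \<epsilon> \<delta> x x' B)) \<and>
    (\<forall>p S x.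
       (\<forall>y\<in>databases n m. is_density \<nu> (output_dist F M y) (p y)) \<longrightarrow>
       (\<forall>y\<in>databases n m. \<forall>y'\<in>databases n m. hamming y y' = 1 \<longrightarrow>
          bad_region F M \<epsilon> \<delta> y y' (S y y')) \<longrightarrow>
       x \<in> X ` (I \<inter> A) \<longrightarrow>
       (AE t in \<nu>. t \<in> space F - (\<Union>x'\<in>X ` ((space Pr - I) \<inter> A). S x x') \<longrightarrow>
          joint_density Pr X p t A > 0 \<longrightarrow>
            1 / (prior Pr I A + (1 - prior Pr I A) * exp \<epsilon>)
              \<le> posterior_prior_ratio Pr X p I A t \<and>
            posterior_prior_ratio Pr X p I A t
              \<le> 1 / (prior Pr I A + (1 - prior Pr I A) * exp (- \<epsilon>))))"
proof (intro conjI allI impI ballI)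
  fix x x' assume xx: "x \<in> databases n m" "x' \<in> databases n m" "hamming x x' = 1"
  then have "hamming x' x = 1"
    using hamming_commute by metis
  with xx assms(14) show "\<exists>B. bad_region F M \<epsilon> \<delta> x x' B"
    by (intro bad_region_exists[OF assms(13) xx(1,2) _ _ assms(12,18,20)])
      (auto simp: approximate_DP_def)
next
  fix p S x
  assume p: "\<forall>y\<in>databases n m. is_density \<nu> (output_dist F M y) (p y)"
    and S: "\<forall>y\<in>databases n m. \<forall>y'\<in>databases n m. hamming y y' = 1 \<longrightarrow>
          bad_region F M \<epsilon> \<delta> y y' (S y y')"
    and x: "x \<in> X ` (I \<inter> A)"
  let ?Y = "X ` ((space Pr - I) \<inter> A)"
  have XD: "X \<omega> \<in> databases n m" if "\<omega> \<in> space Pr" for \<omega>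
    using measurable_space[OF assms(3) that] by simp
  have meas: "{\<omega> \<in> space Pr. Q (X \<omega>)} \<in> sets Pr" for Q
  proof -
    have "{\<omega> \<in> space Pr. Q (X \<omega>)} = X -` {y \<in> databases n m. Q y} \<inter> space Pr"
      using XD by auto
    then show ?thesis
      using measurable_sets[OF assms(3), of "{y \<in> databases n m. Q y}"] by simp
  qed
  have I: "I \<in> sets Pr" and A: "A \<in> sets Pr"
    unfolding I_def A_def by (rule meas)+
  have xD: "x \<in> databases n m" and "xm \<subseteq> x" "i \<in> x"
    using x XD by (auto simp: I_def A_def)
  have YD: "?Y \<subseteq> databases n m"
    using XD by auto
  have "i \<notin> xm" "finite xm"
    using assms(5) finite_subset by auto
  \<comment> \<open>Since \<open>xm\<close> has \<open>m - 1\<close> elements and omits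
    \<open>i\<close>, \<open>insert i xm\<close> is the only database containing both.\<close>
  have const: "X \<omega> = x" if "\<omega> \<in> I \<inter> A" for \<omega>
  proof -
    have unique: "y = insert i xm" if "y \<in> databases n m" "xm \<subseteq> y" "i \<in> y" for y
      using that card_subset_eq[OF finite_database[OF that(1)], of "insert i xm"]
        \<open>i \<notin> xm\<close> \<open>finite xm\<close> assms(1,6) by (auto simp: databases_def)
    show ?thesis
      using unique[OF xD \<open>xm \<subseteq> x\<close> \<open>i \<in> x\<close>] unique[of "X \<omega>"] that XD by (auto simp: I_def A_def)
  qed
  \<comment> \<open>As \<open>X\<close> has only finitely many values, one null set serves all
    \<open>y\<close> at once.\<close>
  have "AE t in \<nu>. \<forall>y\<in>?Y. t \<notin> S x y \<longrightarrow>
      exp (- \<epsilon>) * p y t \<le> p x t \<and> p x t \<le> exp \<epsilon> * p y t"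
  proof (rule AE_finite_allI)
    show "finite ?Y"
      using YD finite_databases by (rule finite_subset)
    fix y assume y: "y \<in> ?Y"
    then have yD: "y \<in> databases n m" and "xm \<subseteq> y" "i \<notin> y"
      using YD by (auto simp: I_def A_def)
    have "hamming x y = 1"
      using assms(1,6) \<open>xm \<subseteq> x\<close> \<open>xm \<subseteq> y\<close> \<open>i \<in> x\<close> \<open>i \<notin> y\<close>
      by (intro hamming_common_subset[OF xD yD]) auto
    then show "AE t in \<nu>. t \<notin> S x y \<longrightarrow>
        exp (- \<epsilon>) * p y t \<le> p x t \<and> p x t \<le> exp \<epsilon> * p y t"
      using p S xD yD by (intro bad_region_AE[OF assms(13) xD yD _ _ assms(16)]) auto
  qed
  then show "AE t in \<nu>. t \<in> space F - (\<Union>x'\<in>?Y. S x x') \<longrightarrow>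
      joint_density Pr X p t A > 0 \<longrightarrow>
        1 / (prior Pr I A + (1 - prior Pr I A) * exp \<epsilon>) \<le> posterior_prior_ratio Pr X p I A t \<and>
        posterior_prior_ratio Pr X p I A t \<le> 1 / (prior Pr I A + (1 - prior Pr I A) * exp (- \<epsilon>))"
    using AE_space
  proof (eventually_elim, intro impI)
    fix t assume t: "\<forall>y\<in>?Y. t \<notin> S x y \<longrightarrow>
        exp (- \<epsilon>) * p y t \<le> p x t \<and> p x t \<le> exp \<epsilon> * p y t"
      and tsp: "t \<in> space \<nu>" and tS: "t \<in> space F - (\<Union>x'\<in>?Y. S x x')"
      and pos: "joint_density Pr X p t A > 0"
    have close: "exp (- \<epsilon>) * p y t \<le> p x t \<and> p x t \<le> exp \<epsilon> * p y t" if "y \<in> ?Y" for y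
      using t tS that by blast
    have "p x t \<ge> 0"
      using p xD tsp by (auto simp: is_density_def)
    note bounds = posterior_prior_ratio_bounds[OF assms(2,3) finite_databases I A assms(9,10) const this close pos]
    show "1 / (prior Pr I A + (1 - prior Pr I A) * exp \<epsilon>) \<le> posterior_prior_ratio Pr X p I A t \<and>
        posterior_prior_ratio Pr X p I A t \<le> 1 / (prior Pr I A + (1 - prior Pr I A) * exp (- \<epsilon>))"
      using bounds by blast
  qed
qed

end
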